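(* Let $p<q$ be primes, let $s$ be an even divisor of $p-1$ and $r$ a divisor of $q-1$, let $H(p,s)=\langle a\rangle$, let $t\in\mathbb{Z}_q^*$ be such that $t^{s/2}\in -H(q,r)$, let $u=\mathrm{lcm}(r,o(t))$, and let $G(pq;r,s,u)$ be the graph defined by these data. Then $G(p,s)\times G(q,u)$ is symmetric, and $G(pq;r,s,u)$ is isomorphic to a spanning subgraph of $G(p,s)\times G(q,u)$. Moreover, $G(pq;r,s,u)\cong G(p,s)\times G(q,u)$ if and only if $t\in H(q,r)$.
   Context: For a prime $p$ and a positive divisor $r$ of $p-1$, $H(p,r)$ is the unique subgroup of order $r$ of $\mathbb{Z}_p^*$, and $G(p,r)$ is the circulant graph on $\mathbb{Z}_p$ with $x,y$ adjacent iff $y-x\in H(p,r)$. $o(t)$ is the order of $t$ in $\mathbb{Z}_q^*$. The graph $G(pq;r,s,u)$ has vertex set $\mathbb{Z}_p\times\mathbb{Z}_q$, with $(i,x),(j,y)$ adjacent iff there is an integer $l$ such that $j-i=a^l$ and $y-x\in t^lH(q,r)$. (Here $u$ divides $q-1$, so $G(q,u)$ is well defined.) The categorical product $\Gamma\times\Psi$ has vertex set $V(\Gamma)\times V(\Psi)$ with $(u,x),(v,y)$ adjacent iff $\{u,v\}\in E(\Gamma)$ and $\{x,y\}\in E(\Psi)$. A graph is symmetric if its automorphism group is transitive on vertices and on arcs (ordered pairs of adjacent vertices). *)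

theory Defs
  imports
    "HOL-Number_Theory.Residues"
    "HOL-Algebra.Group_Action"
    "HOL-Algebra.Generated_Groups"
    "Graph_Theory.Pair_Digraph"
    "Graph_Theory.Digraph_Component"
    "Graph_Theory.Digraph_Isomorphism"
begin

text \<open>
  A graph is a pair digraph whose arc set is symmetric and irreflexive (\<open>pair_graph\<close>);
  the edge \<open>{x, y}\<close> is represented by the two arcs \<open>(x, y)\<close> and \<open>(y, x)\<close>.
\<close>


subsection \<open>Symmetric graphs and categorical products\<close>

definition graph_automorphisms :: "'a pair_pre_digraph \<Rightarrow> ('a \<Rightarrow> 'a) set" where
  "graph_automorphisms G =
     {f \<in> Bij (pverts G).
        \<forall>x\<in>pverts G. \<forall>y\<in>pverts G. (f x, f y) \<in> parcs G \<longleftrightarrow> (x, y) \<in> parcs G}"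

definition graph_Aut :: "'a pair_pre_digraph \<Rightarrow> ('a \<Rightarrow> 'a) monoid" where
  "graph_Aut G = BijGroup (pverts G) \<lparr>carrier := graph_automorphisms G\<rparr>"

definition symmetric_graph :: "'a pair_pre_digraph \<Rightarrow> bool" where
  "symmetric_graph G \<longleftrightarrow>
     transitive_action (graph_Aut G) (pverts G) (\<lambda>f. f) \<and>
     transitive_action (graph_Aut G) (parcs G) (\<lambda>f. restrict (map_prod f f) (parcs G))"

definition categorical_product ::
    "'a pair_pre_digraph \<Rightarrow> 'b pair_pre_digraph \<Rightarrow> ('a \<times> 'b) pair_pre_digraph" where
  "categorical_product \<Gamma> \<Psi> =
     \<lparr> pverts = pverts \<Gamma> \<times> pverts \<Psi>,
       parcs = {((u, x), (v, y)) | u x v y. (u, v) \<in> parcs \<Gamma> \<and> (x, y) \<in> parcs \<Psi>} \<rparr>"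


subsection \<open>The graphs $G(p,r)$ and $G(pq;r,s,u)$\<close>

text \<open>The ring of integers modulo \<open>n\<close> (on the representatives \<open>{0..n - 1}\<close>) and its unit group.\<close>

abbreviation Zmod :: "nat \<Rightarrow> int ring" where
  "Zmod n \<equiv> residue_ring (int n)"

abbreviation Zstar :: "nat \<Rightarrow> int monoid" where
  "Zstar n \<equiv> units_of (Zmod n)"

definition Hsub :: "nat \<Rightarrow> nat \<Rightarrow> int set" where
  "Hsub p r = (THE H. subgroup H (Zstar p) \<and> card H = r)"

definition circulant_G :: "nat \<Rightarrow> nat \<Rightarrow> int pair_pre_digraph" where
  "circulant_G p r =
     \<lparr> pverts = carrier (Zmod p),
       parcs = {(x, y). x \<in> carrier (Zmod p) \<and> y \<in> carrier (Zmod p) \<and>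
                        y \<ominus>\<^bsub>Zmod p\<^esub> x \<in> Hsub p r} \<rparr>"

text \<open>
  The adjacency in $G(pq;r,s,u)$ depends on the chosen \<open>a\<close> and \<open>t\<close>, whereas \<open>s\<close> and \<open>u\<close> are
  determined by these and \<open>r\<close> (\<open>s\<close> is the order of \<open>a\<close> and \<open>u = lcm r (o t)\<close>). Hence the
  arguments below.
\<close>

definition graph_pq :: "nat \<Rightarrow> nat \<Rightarrow> nat \<Rightarrow> int \<Rightarrow> int \<Rightarrow> (int \<times> int) pair_pre_digraph" where
  "graph_pq p q r a t =
     \<lparr> pverts = carrier (Zmod p) \<times> carrier (Zmod q),
       parcs = {((i, x), (j, y)) | i x j y.
                  i \<in> carrier (Zmod p) \<and> x \<in> carrier (Zmod q) \<and>
                  j \<in> carrier (Zmod p) \<and> y \<in> carrier (Zmod q) \<and>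
                  (\<exists>l::int. j \<ominus>\<^bsub>Zmod p\<^esub> i = a [^]\<^bsub>Zstar p\<^esub> l \<and>
                            y \<ominus>\<^bsub>Zmod q\<^esub> x \<in> (t [^]\<^bsub>Zstar q\<^esub> l) <#\<^bsub>Zstar q\<^esub> Hsub q r)} \<rparr>"


subsection \<open>Well-definedness\<close>

text \<open>
  \<open>Hsub p r\<close> is indeed the unique subgroup of order \<open>r\<close>, the graphs that occur in the statement are
  simple undirected graphs, and \<open>symmetric_graph\<close> amounts to the elementwise condition.
\<close>

lemma Hsub_aux:
  assumes "prime p" "r dvd p - 1" "subgroup H (Zstar p)" "card H = r"
  shows "H = {x \<in> carrier (Zstar p). x [^]\<^bsub>Zstar p\<^esub> r = \<one>\<^bsub>Zstar p\<^esub>}"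
proof -
  interpret residues_prime p "Zmod p" using assms(1) by unfold_locales simp
  interpret U: group "Zstar p" by (rule units_group)
  have r0: "r > 0" using dvd_pos_nat[of "p - 1" r] assms(1,2) prime_gt_1_nat[of p] by simp
  have fin: "finite (carrier (Zstar p))" by (simp add: units_of_carrier)
  have sub: "H \<subseteq> {x \<in> carrier (Zstar p). x [^]\<^bsub>Zstar p\<^esub> r = \<one>\<^bsub>Zstar p\<^esub>}"
  proof
    fix x assume x: "x \<in> H"
    interpret S: group "(Zstar p)\<lparr>carrier := H\<rparr>"
      using assms(3) U.subgroup_imp_group by blast
    have "x [^]\<^bsub>(Zstar p)\<lparr>carrier := H\<rparr>\<^esub> card H = \<one>\<^bsub>Zstar p\<^esub>"
      using S.pow_order_eq_1[of x] x by (simp add: order_def)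
    then have "x [^]\<^bsub>Zstar p\<^esub> r = \<one>\<^bsub>Zstar p\<^esub>"
      using U.nat_pow_consistent[of x "card H" H] assms(4) by simp
    then show "x \<in> {x \<in> carrier (Zstar p). x [^]\<^bsub>Zstar p\<^esub> r = \<one>\<^bsub>Zstar p\<^esub>}"
      using x assms(3) subgroup.mem_carrier by fastforce
  qed
  have "{x \<in> carrier (Zstar p). x [^]\<^bsub>Zstar p\<^esub> r = \<one>\<^bsub>Zstar p\<^esub>} \<subseteq>
        {x \<in> carrier (Zmod p). x [^]\<^bsub>Zmod p\<^esub> r = \<one>\<^bsub>Zmod p\<^esub>}"
    using units_of_pow by (auto simp: units_of_carrier units_of_one)
  then have "card {x \<in> carrier (Zstar p). x [^]\<^bsub>Zstar p\<^esub> r = \<one>\<^bsub>Zstar p\<^esub>} \<le>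
             card {x \<in> carrier (Zmod p). x [^]\<^bsub>Zmod p\<^esub> r = \<one>\<^bsub>Zmod p\<^esub>}"
    by (rule card_mono[rotated]) simp
  also have "\<dots> \<le> r" by (rule num_roots_le_deg[OF finite]) (use r0 in simp)
  finally have "card {x \<in> carrier (Zstar p). x [^]\<^bsub>Zstar p\<^esub> r = \<one>\<^bsub>Zstar p\<^esub>} \<le> card H"
    using assms(4) by simp
  then show ?thesis by (rule card_seteq[OF _ sub, rotated]) (use fin in simp)
qed

lemma Hsub_ex:
  assumes "prime p" "r dvd p - 1"
  shows "\<exists>H. subgroup H (Zstar p) \<and> card H = r"
proof -
  interpret residues_prime p "Zmod p" using assms(1) by unfold_locales simp
  interpret U: group "Zstar p" by (rule units_group)
  have fin: "finite (carrier (Zstar p))" by (simp add: units_of_carrier)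
  have card: "order (Zstar p) = p - 1"
    unfolding order_def units_of_carrier res_prime_units_eq by (simp add: nat_diff_distrib)
  have p1: "p - 1 > 0" using assms(1) prime_gt_1_nat[of p] by simp
  obtain g where g: "g \<in> carrier (Zstar p)" "carrier (Zstar p) = {g [^]\<^bsub>Zmod p\<^esub> i | i::nat. i \<in> UNIV}"
    using finite_field_mult_group_has_gen mult_of_is_Units by auto
  have gen: "carrier (Zstar p) = generate (Zstar p) {g}"
    using U.generate_pow_on_finite_carrier[OF fin g(1)] g units_of_pow
    by (simp add: units_of_carrier)
  then have og: "U.ord g = p - 1"
    using U.generate_pow_card[OF g(1)] card by (simp add: order_def)
  obtain k where k: "p - 1 = r * k" using assms(2) by blast
  have "U.ord (g [^]\<^bsub>Zstar p\<^esub> k) = r"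
    using U.ord_pow[OF g(1), of k] og k p1 by auto
  then have "card (generate (Zstar p) {g [^]\<^bsub>Zstar p\<^esub> k}) = r"
    using U.generate_pow_card g(1) by simp
  moreover have "subgroup (generate (Zstar p) {g [^]\<^bsub>Zstar p\<^esub> k}) (Zstar p)"
    by (rule U.generate_is_subgroup) (use g(1) in auto)
  ultimately show ?thesis by blast
qed

lemma Hsub_unique:
  assumes "prime p" "r dvd p - 1"
  shows "\<exists>!H. subgroup H (Zstar p) \<and> card H = r"
proof (rule ex_ex1I)
  show "\<exists>H. subgroup H (Zstar p) \<and> card H = r" by (rule Hsub_ex[OF assms])
next
  fix H K assume H: "subgroup H (Zstar p) \<and> card H = r" and K: "subgroup K (Zstar p) \<and> card K = r"
  show "H = K"
    by (rule trans[OF Hsub_aux[OF assms conjunct1[OF H] conjunct2[OF H]]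
          Hsub_aux[OF assms conjunct1[OF K] conjunct2[OF K], symmetric]])
qed

lemma subgroup_Hsub: "subgroup (Hsub p r) (Zstar p)"
  and card_Hsub: "card (Hsub p r) = r"
  if "prime p" "r dvd p - 1"
proof -
  have *: "subgroup (Hsub p r) (Zstar p) \<and> card (Hsub p r) = r"
    unfolding Hsub_def by (rule theI'[OF Hsub_unique[OF that]])
  show "subgroup (Hsub p r) (Zstar p)" by (rule conjunct1[OF *])
  show "card (Hsub p r) = r" by (rule conjunct2[OF *])
qed

lemma Hsub_eq_roots:
  assumes "prime p" "r dvd p - 1"
  shows "Hsub p r = {x \<in> carrier (Zstar p). x [^]\<^bsub>Zstar p\<^esub> r = \<one>\<^bsub>Zstar p\<^esub>}"
  using Hsub_aux[OF assms subgroup_Hsub[OF assms] card_Hsub[OF assms]] .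

lemma pair_graph_circulant_G:
  assumes "prime p" "r dvd p - 1" "\<ominus>\<^bsub>Zmod p\<^esub> \<one>\<^bsub>Zmod p\<^esub> \<in> Hsub p r"
  shows "pair_graph (circulant_G p r)"
proof -
  interpret residues_prime p "Zmod p" using assms(1) by unfold_locales simp
  interpret H: subgroup "Hsub p r" "Zstar p" using subgroup_Hsub assms by blast
  have fin: "finite (carrier (Zmod p) \<times> carrier (Zmod p))" by simp
  have neg: "\<ominus>\<^bsub>Zmod p\<^esub> h \<in> Hsub p r" if "h \<in> Hsub p r" for h
  proof -
    have "h \<in> carrier (Zmod p)" using H.mem_carrier[OF that] by (auto simp: units_of_carrier)
    then have "\<ominus>\<^bsub>Zmod p\<^esub> h = (\<ominus>\<^bsub>Zmod p\<^esub> \<one>\<^bsub>Zmod p\<^esub>) \<otimes>\<^bsub>Zstar p\<^esub> h"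
      by (simp add: units_of_mult l_minus)
    then show ?thesis using H.m_closed[OF assms(3) that] by simp
  qed
  have swap: "x \<ominus>\<^bsub>Zmod p\<^esub> y = \<ominus>\<^bsub>Zmod p\<^esub> (y \<ominus>\<^bsub>Zmod p\<^esub> x)"
    if "x \<in> carrier (Zmod p)" "y \<in> carrier (Zmod p)" for x y
  proof -
    have "\<ominus>\<^bsub>Zmod p\<^esub> (y \<ominus>\<^bsub>Zmod p\<^esub> x) = \<ominus>\<^bsub>Zmod p\<^esub> y \<oplus>\<^bsub>Zmod p\<^esub> \<ominus>\<^bsub>Zmod p\<^esub> (\<ominus>\<^bsub>Zmod p\<^esub> x)"
      unfolding minus_eq by (rule minus_add) (use that in auto)
    also have "\<dots> = \<ominus>\<^bsub>Zmod p\<^esub> y \<oplus>\<^bsub>Zmod p\<^esub> x" using that by simp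
    also have "\<dots> = x \<ominus>\<^bsub>Zmod p\<^esub> y" unfolding minus_eq by (rule a_comm) (use that in auto)
    finally show ?thesis by simp
  qed
  have zero: "\<zero>\<^bsub>Zmod p\<^esub> \<notin> Hsub p r"
    using H.subset field_Units by (auto simp: units_of_carrier)
  have zero': "x \<ominus>\<^bsub>Zmod p\<^esub> x = \<zero>\<^bsub>Zmod p\<^esub>" if "x \<in> carrier (Zmod p)" for x
    using that by (simp add: minus_eq r_neg)
  show ?thesis
  proof
    show "finite (parcs (circulant_G p r))"
      by (rule finite_subset[OF _ fin]) (auto simp: circulant_G_def)
    show "symmetric (with_proj (circulant_G p r))"
      unfolding symmetric_def
    proof (rule symI)
      fix x y assume "(x, y) \<in> arcs_ends (with_proj (circulant_G p r))"
      then have *: "x \<in> carrier (Zmod p)" "y \<in> carrier (Zmod p)" "y \<ominus>\<^bsub>Zmod p\<^esub> x \<in> Hsub p r"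
        by (simp_all add: circulant_G_def)
      have "x \<ominus>\<^bsub>Zmod p\<^esub> y \<in> Hsub p r"
        unfolding swap[OF *(1,2)] by (rule neg[OF *(3)])
      then show "(y, x) \<in> arcs_ends (with_proj (circulant_G p r))"
        using * by (simp add: circulant_G_def)
    qed
  qed (auto simp: circulant_G_def zero zero')
qed

lemma minus_one_in_Hsub:
  assumes "prime p" "r dvd p - 1" "even r"
  shows "\<ominus>\<^bsub>Zmod p\<^esub> \<one>\<^bsub>Zmod p\<^esub> \<in> Hsub p r"
proof -
  interpret residues_prime p "Zmod p" using assms(1) by unfold_locales simp
  obtain k where k: "r = 2 * k" using assms(3) by blast
  have u: "\<ominus>\<^bsub>Zmod p\<^esub> \<one>\<^bsub>Zmod p\<^esub> \<in> Units (Zmod p)"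
    by (rule Units_minus_one_closed)
  have "(\<ominus>\<^bsub>Zmod p\<^esub> \<one>\<^bsub>Zmod p\<^esub>) [^]\<^bsub>Zmod p\<^esub> (2::nat) = \<one>\<^bsub>Zmod p\<^esub>"
    by (simp add: numeral_2_eq_2 l_minus)
  then have "(\<ominus>\<^bsub>Zmod p\<^esub> \<one>\<^bsub>Zmod p\<^esub>) [^]\<^bsub>Zmod p\<^esub> r = \<one>\<^bsub>Zmod p\<^esub>"
    unfolding k using u by (metis Units_closed nat_pow_one nat_pow_pow)
  then show ?thesis using u
    by (simp add: Hsub_eq_roots[OF assms(1,2)] units_of_carrier units_of_one units_of_pow)
qed

lemma pair_graph_categorical_product:
  assumes "pair_graph \<Gamma>" "pair_graph \<Psi>"
  shows "pair_graph (categorical_product \<Gamma> \<Psi>)"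
proof -
  interpret A: pair_graph \<Gamma> by fact
  interpret B: pair_graph \<Psi> by fact
  show ?thesis
  proof
    show "finite (parcs (categorical_product \<Gamma> \<Psi>))"
      by (rule finite_subset[of _ "(pverts \<Gamma> \<times> pverts \<Psi>) \<times> (pverts \<Gamma> \<times> pverts \<Psi>)"])
        (auto simp: categorical_product_def dest: A.wellformed' B.wellformed')
    show "symmetric (with_proj (categorical_product \<Gamma> \<Psi>))"
      unfolding symmetric_def
      by (rule symI) (auto simp: categorical_product_def dest: A.arcs_symmetric B.arcs_symmetric)
  qed (auto simp: categorical_product_def dest: A.wellformed' B.wellformed' A.no_loops B.no_loops)
qed

lemma group_graph_Aut: "group (graph_Aut G)"
proof -
  interpret B: group "BijGroup (pverts G)" by (rule group_BijGroup)
  have "subgroup (graph_automorphisms G) (BijGroup (pverts G))"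
  proof (rule B.subgroupI)
    show "graph_automorphisms G \<subseteq> carrier (BijGroup (pverts G))"
      by (auto simp: graph_automorphisms_def BijGroup_def)
    have "(\<lambda>x\<in>pverts G. x) \<in> graph_automorphisms G"
      by (auto simp: graph_automorphisms_def id_Bij)
    then show "graph_automorphisms G \<noteq> {}" by blast
  next
    fix f assume f: "f \<in> graph_automorphisms G"
    then have fB: "f \<in> Bij (pverts G)" by (simp add: graph_automorphisms_def)
    let ?g = "inv_into (pverts G) f"
    have im: "f ` pverts G = pverts G" using fB by (simp add: Bij_def bij_betw_def)
    have g: "?g x \<in> pverts G" "f (?g x) = x" if "x \<in> pverts G" for x
      using that im by (metis inv_into_into, metis f_inv_into_f)
    have "(?g x, ?g y) \<in> parcs G \<longleftrightarrow> (x, y) \<in> parcs G"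
      if "x \<in> pverts G" "y \<in> pverts G" for x y
    proof -
      have "(f (?g x), f (?g y)) \<in> parcs G \<longleftrightarrow> (?g x, ?g y) \<in> parcs G"
        using f g(1)[OF that(1)] g(1)[OF that(2)] by (simp add: graph_automorphisms_def)
      then show ?thesis using g(2)[OF that(1)] g(2)[OF that(2)] by simp
    qed
    then show "inv\<^bsub>BijGroup (pverts G)\<^esub> f \<in> graph_automorphisms G"
      unfolding inv_BijGroup[OF fB] by (simp add: graph_automorphisms_def restrict_inv_into_Bij fB)
  next
    fix f g assume "f \<in> graph_automorphisms G" "g \<in> graph_automorphisms G"
    then show "f \<otimes>\<^bsub>BijGroup (pverts G)\<^esub> g \<in> graph_automorphisms G"
      using Bij_imp_funcset[of g "pverts G"]
      by (auto simp: graph_automorphisms_def BijGroup_def compose_Bij compose_eq Pi_iff)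
  qed
  then show ?thesis unfolding graph_Aut_def by (rule B.subgroup_imp_group)
qed

lemma group_action_verts: "group_action (graph_Aut G) (pverts G) (\<lambda>f. f)"
  using group_graph_Aut[of G] group_BijGroup[of "pverts G"]
  by (auto simp: group_action_def group_hom_def group_hom_axioms_def hom_def graph_Aut_def
    graph_automorphisms_def BijGroup_def)

lemma group_action_arcs:
  assumes "pair_wf_digraph G"
  shows "group_action (graph_Aut G) (parcs G) (\<lambda>f. restrict (map_prod f f) (parcs G))"
proof -
  interpret pair_wf_digraph G by fact
  have B: "restrict (map_prod f f) (parcs G) \<in> Bij (parcs G)" if f: "f \<in> graph_automorphisms G" for f
  proof -
    have fB: "f \<in> Bij (pverts G)" using f by (simp add: graph_automorphisms_def)
    have im: "f ` pverts G = pverts G" and inj: "inj_on f (pverts G)"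
      using fB by (simp_all add: Bij_def bij_betw_def)
    have "inj_on (map_prod f f) (parcs G)"
      by (rule inj_on_subset[OF map_prod_inj_on[OF inj inj]]) (auto dest: wellformed')
    moreover have "map_prod f f ` parcs G = parcs G"
    proof (intro equalityI subsetI)
      fix e assume "e \<in> map_prod f f ` parcs G"
      then show "e \<in> parcs G" using f
        by (auto simp: graph_automorphisms_def dest: wellformed')
    next
      fix e assume e: "e \<in> parcs G"
      obtain x y where xy: "e = (x, y)" by (cases e)
      then have "x \<in> f ` pverts G" "y \<in> f ` pverts G" using e im by (auto dest: wellformed')
      then obtain u v where "u \<in> pverts G" "v \<in> pverts G" "x = f u" "y = f v" by blast
      moreover from this have "(u, v) \<in> parcs G"
        using f e xy by (auto simp: graph_automorphisms_def)
      ultimately show "e \<in> map_prod f f ` parcs G" using xy by force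
    qed
    ultimately show ?thesis by (simp add: Bij_def bij_betw_def inj_on_def)
  qed
  have "(\<lambda>f. restrict (map_prod f f) (parcs G)) \<in> hom (graph_Aut G) (BijGroup (parcs G))"
  proof (rule homI)
    fix f assume "f \<in> carrier (graph_Aut G)"
    then show "restrict (map_prod f f) (parcs G) \<in> carrier (BijGroup (parcs G))"
      using B by (simp add: graph_Aut_def BijGroup_def)
  next
    fix f g assume "f \<in> carrier (graph_Aut G)" "g \<in> carrier (graph_Aut G)"
    then have fg: "f \<in> graph_automorphisms G" "g \<in> graph_automorphisms G"
      by (simp_all add: graph_Aut_def)
    then have fg': "f \<in> Bij (pverts G)" "g \<in> Bij (pverts G)" by (simp_all add: graph_automorphisms_def)
    show "restrict (map_prod (f \<otimes>\<^bsub>graph_Aut G\<^esub> g) (f \<otimes>\<^bsub>graph_Aut G\<^esub> g)) (parcs G) =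
      restrict (map_prod f f) (parcs G) \<otimes>\<^bsub>BijGroup (parcs G)\<^esub> restrict (map_prod g g) (parcs G)"
      using B[OF fg(1)] B[OF fg(2)] fg fg'
      by (auto simp: fun_eq_iff graph_Aut_def BijGroup_def compose_def restrict_def
          graph_automorphisms_def dest: wellformed')
  qed
  then show ?thesis
    using group_graph_Aut[of G] group_BijGroup[of "parcs G"]
    by (simp add: group_action_def group_hom_def group_hom_axioms_def)
qed

lemma symmetric_graph_iff:
  assumes "pair_wf_digraph G"
  shows "symmetric_graph G \<longleftrightarrow>
    (\<forall>x\<in>pverts G. \<forall>y\<in>pverts G. \<exists>f\<in>graph_automorphisms G. f x = y) \<and>
    (\<forall>(x, y)\<in>parcs G. \<forall>(u, v)\<in>parcs G. \<exists>f\<in>graph_automorphisms G. f x = u \<and> f y = v)"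
proof -
  have "transitive_action (graph_Aut G) (pverts G) (\<lambda>f. f) \<longleftrightarrow>
    (\<forall>x\<in>pverts G. \<forall>y\<in>pverts G. \<exists>f\<in>graph_automorphisms G. f x = y)"
    using group_action_verts[of G]
    by (auto simp: transitive_action_def transitive_action_axioms_def graph_Aut_def)
  moreover have "transitive_action (graph_Aut G) (parcs G) (\<lambda>f. restrict (map_prod f f) (parcs G)) \<longleftrightarrow>
    (\<forall>(x, y)\<in>parcs G. \<forall>(u, v)\<in>parcs G. \<exists>f\<in>graph_automorphisms G. f x = u \<and> f y = v)"
    using group_action_arcs[OF assms]
    by (fastforce simp: transitive_action_def transitive_action_axioms_def graph_Aut_def)
  ultimately show ?thesis by (simp add: symmetric_graph_def)
qed

lemma (in ring) minus_swap:
  assumes "x \<in> carrier R" "y \<in> carrier R"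
  shows "x \<ominus> y = (\<ominus> \<one>) \<otimes> (y \<ominus> x)"
proof -
  have "(\<ominus> \<one>) \<otimes> (y \<ominus> x) = \<ominus> (y \<oplus> \<ominus> x)"
    using assms by (simp add: l_minus minus_eq)
  also have "\<dots> = \<ominus> y \<oplus> \<ominus> (\<ominus> x)"
    by (rule minus_add) (use assms in auto)
  also have "\<dots> = \<ominus> y \<oplus> x" using assms by simp
  also have "\<dots> = x \<oplus> \<ominus> y" by (rule a_comm) (use assms in auto)
  finally show ?thesis by (simp add: minus_eq)
qed

lemma lcm_ord_dvd:
  assumes "prime q" "r dvd q - 1" "t \<in> carrier (Zstar q)"
  shows "lcm r (group.ord (Zstar q) t) dvd q - 1"
proof -
  interpret residues_prime q "Zmod q" using assms(1) by unfold_locales simp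
  interpret U: group "Zstar q" by (rule units_group)
  have "order (Zstar q) = q - 1"
    unfolding order_def units_of_carrier res_prime_units_eq by (simp add: nat_diff_distrib)
  then show ?thesis using U.ord_dvd_group_order[OF assms(3)] assms(2) by (auto intro: lcm_least)
qed

lemma pow_half_eq_minus_one:
  assumes "prime p" "even s" "s dvd p - 1" "a \<in> carrier (Zstar p)"
    and "Hsub p s = generate (Zstar p) {a}"
  shows "a [^]\<^bsub>Zstar p\<^esub> (s div 2) = \<ominus>\<^bsub>Zmod p\<^esub> \<one>\<^bsub>Zmod p\<^esub>"
proof -
  interpret residues_prime p "Zmod p" using assms(1) by unfold_locales simp
  interpret U: group "Zstar p" by (rule units_group)
  let ?x = "a [^]\<^bsub>Zstar p\<^esub> (s div 2)"
  have s0: "s > 0" using dvd_pos_nat[of "p - 1" s] assms(1,3) prime_gt_1_nat[of p] by simp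
  have ord: "U.ord a = s"
    using U.generate_pow_card[OF assms(4)] assms(5) card_Hsub[OF assms(1,3)] by simp
  have "\<not> s dvd s div 2" using s0 assms(2) by (auto dest: dvd_imp_le)
  then have ne: "?x \<noteq> \<one>\<^bsub>Zmod p\<^esub>"
    using U.pow_eq_id[OF assms(4), of "s div 2"] ord by (simp add: units_of_one)
  have "?x \<otimes>\<^bsub>Zstar p\<^esub> ?x = a [^]\<^bsub>Zstar p\<^esub> s"
    using assms(2,4) by (simp add: U.nat_pow_mult flip: mult_2)
  then have sq: "?x \<otimes>\<^bsub>Zmod p\<^esub> ?x = \<one>\<^bsub>Zmod p\<^esub>"
    using U.pow_ord_eq_1[OF assms(4)] ord by (simp add: units_of_one units_of_mult)
  have "?x \<in> carrier (Zstar p)" using assms(4) by simp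
  then have "?x \<in> carrier (Zmod p)" by (auto simp: units_of_carrier)
  from square_eq_one[OF this sq] ne show ?thesis by simp
qed

lemma minus_one_eq:
  assumes "prime q" "r dvd q - 1" "t \<in> carrier (Zstar q)"
    and "t [^]\<^bsub>Zstar q\<^esub> (m::nat) \<in> a_inv (Zmod q) ` Hsub q r"
  shows "\<exists>k\<in>Hsub q r. \<ominus>\<^bsub>Zmod q\<^esub> \<one>\<^bsub>Zmod q\<^esub> = t [^]\<^bsub>Zstar q\<^esub> m \<otimes>\<^bsub>Zstar q\<^esub> k"
proof -
  interpret residues_prime q "Zmod q" using assms(1) by unfold_locales simp
  interpret U: group "Zstar q" by (rule units_group)
  interpret H: subgroup "Hsub q r" "Zstar q" by (rule subgroup_Hsub[OF assms(1,2)])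
  obtain h where h: "h \<in> Hsub q r" "t [^]\<^bsub>Zstar q\<^esub> m = \<ominus>\<^bsub>Zmod q\<^esub> h"
    using assms(4) by blast
  let ?k = "inv\<^bsub>Zstar q\<^esub> h"
  have k: "?k \<in> Hsub q r" using h(1) by (rule H.m_inv_closed)
  have hc: "h \<in> carrier (Zmod q)" "?k \<in> carrier (Zmod q)"
    using H.mem_carrier[OF h(1)] H.mem_carrier[OF k] by (auto simp: units_of_carrier)
  have "h \<otimes>\<^bsub>Zstar q\<^esub> ?k = \<one>\<^bsub>Zstar q\<^esub>" using U.r_inv[OF H.mem_carrier[OF h(1)]] .
  then have "\<ominus>\<^bsub>Zmod q\<^esub> h \<otimes>\<^bsub>Zmod q\<^esub> ?k = \<ominus>\<^bsub>Zmod q\<^esub> \<one>\<^bsub>Zmod q\<^esub>"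
    using hc by (simp add: l_minus units_of_mult units_of_one)
  then show ?thesis using k h(2) by (intro bexI[of _ ?k]) (simp_all add: units_of_mult)
qed

lemma pair_graph_circulant_lcm:
  assumes "prime q" "r dvd q - 1" "t \<in> carrier (Zstar q)"
    and "t [^]\<^bsub>Zstar q\<^esub> (m::nat) \<in> a_inv (Zmod q) ` Hsub q r"
  shows "pair_graph (circulant_G q (lcm r (group.ord (Zstar q) t)))"
proof (rule pair_graph_circulant_G[OF assms(1) lcm_ord_dvd[OF assms(1-3)]])
  interpret residues_prime q "Zmod q" using assms(1) by unfold_locales simp
  interpret U: group "Zstar q" by (rule units_group)
  let ?u = "lcm r (U.ord t)"
  interpret K: subgroup "Hsub q ?u" "Zstar q"
    by (rule subgroup_Hsub[OF assms(1) lcm_ord_dvd[OF assms(1-3)]])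
  have roots: "x \<in> Hsub q ?u" if "x \<in> carrier (Zstar q)" "U.ord x dvd ?u" for x
    unfolding Hsub_eq_roots[OF assms(1) lcm_ord_dvd[OF assms(1-3)]]
    using that U.pow_eq_id[OF that(1), of ?u] by blast
  obtain k where k: "k \<in> Hsub q r"
    "\<ominus>\<^bsub>Zmod q\<^esub> \<one>\<^bsub>Zmod q\<^esub> = t [^]\<^bsub>Zstar q\<^esub> m \<otimes>\<^bsub>Zstar q\<^esub> k"
    using minus_one_eq[OF assms] by blast
  have "k \<in> carrier (Zstar q)" "U.ord k dvd r"
    using k(1) U.pow_eq_id[of k r] unfolding Hsub_eq_roots[OF assms(1,2)] by blast+
  then have "k \<in> Hsub q ?u"
    by (intro roots) (simp_all only: dvd_lcmI1)
  moreover have "t \<in> Hsub q ?u" by (rule roots[OF assms(3) dvd_lcm2])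
  then have "t [^]\<^bsub>Zstar q\<^esub> m \<in> Hsub q ?u"
    by (induction m) (simp_all add: K.one_closed K.m_closed)
  ultimately show "\<ominus>\<^bsub>Zmod q\<^esub> \<one>\<^bsub>Zmod q\<^esub> \<in> Hsub q ?u"
    unfolding k(2) by (rule K.m_closed[rotated])
qed

lemma pair_graph_graph_pq:
  assumes "prime p" "prime q" "even s" "s dvd p - 1" "r dvd q - 1"
    and "a \<in> carrier (Zstar p)" "Hsub p s = generate (Zstar p) {a}"
    and "t \<in> carrier (Zstar q)"
    and "t [^]\<^bsub>Zstar q\<^esub> (s div 2) \<in> a_inv (Zmod q) ` Hsub q r"
  shows "pair_graph (graph_pq p q r a t)"
proof -
  interpret P: residues_prime p "Zmod p" using assms(1) by unfold_locales simp
  interpret Q: residues_prime q "Zmod q" using assms(2) by unfold_locales simp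
  interpret UP: group "Zstar p" by (rule P.units_group)
  interpret UQ: comm_group "Zstar q" by (rule Q.units_comm_group)
  interpret H: subgroup "Hsub q r" "Zstar q" by (rule subgroup_Hsub[OF assms(2,5)])
  obtain k where k: "k \<in> Hsub q r"
    "\<ominus>\<^bsub>Zmod q\<^esub> \<one>\<^bsub>Zmod q\<^esub> = t [^]\<^bsub>Zstar q\<^esub> (s div 2) \<otimes>\<^bsub>Zstar q\<^esub> k"
    using minus_one_eq[OF assms(2,5,8,9)] by blast
  have swapP: "x \<ominus>\<^bsub>Zmod p\<^esub> y = (\<ominus>\<^bsub>Zmod p\<^esub> \<one>\<^bsub>Zmod p\<^esub>) \<otimes>\<^bsub>Zmod p\<^esub> (y \<ominus>\<^bsub>Zmod p\<^esub> x)"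
    if "x \<in> carrier (Zmod p)" "y \<in> carrier (Zmod p)" for x y
    using that by (rule P.minus_swap)
  have swapQ: "x \<ominus>\<^bsub>Zmod q\<^esub> y = (\<ominus>\<^bsub>Zmod q\<^esub> \<one>\<^bsub>Zmod q\<^esub>) \<otimes>\<^bsub>Zmod q\<^esub> (y \<ominus>\<^bsub>Zmod q\<^esub> x)"
    if "x \<in> carrier (Zmod q)" "y \<in> carrier (Zmod q)" for x y
    using that by (rule Q.minus_swap)
  have half: "\<ominus>\<^bsub>Zmod p\<^esub> \<one>\<^bsub>Zmod p\<^esub> = a [^]\<^bsub>Zstar p\<^esub> int (s div 2)"
    using pow_half_eq_minus_one[OF assms(1,3,4,6,7)] by (simp only: int_pow_int)
  have negP: "(\<ominus>\<^bsub>Zmod p\<^esub> \<one>\<^bsub>Zmod p\<^esub>) \<otimes>\<^bsub>Zmod p\<^esub> (a [^]\<^bsub>Zstar p\<^esub> l) = a [^]\<^bsub>Zstar p\<^esub> (int (s div 2) + l)" for l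
    unfolding half using UP.int_pow_mult[OF assms(6), of "int (s div 2)" l]
    by (simp only: units_of_mult)
  have negQ: "(\<ominus>\<^bsub>Zmod q\<^esub> \<one>\<^bsub>Zmod q\<^esub>) \<otimes>\<^bsub>Zmod q\<^esub> z \<in> (t [^]\<^bsub>Zstar q\<^esub> (int (s div 2) + l)) <#\<^bsub>Zstar q\<^esub> Hsub q r"
    if z: "z \<in> (t [^]\<^bsub>Zstar q\<^esub> l) <#\<^bsub>Zstar q\<^esub> Hsub q r" for z and l :: int
  proof -
    obtain h where h: "h \<in> Hsub q r" "z = t [^]\<^bsub>Zstar q\<^esub> l \<otimes>\<^bsub>Zstar q\<^esub> h"
      using z by (auto simp: l_coset_def)
    have c: "h \<in> carrier (Zstar q)" "k \<in> carrier (Zstar q)"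
      "t [^]\<^bsub>Zstar q\<^esub> l \<in> carrier (Zstar q)" "t [^]\<^bsub>Zstar q\<^esub> int (s div 2) \<in> carrier (Zstar q)"
      using h k assms(8) by (simp_all only: H.mem_carrier UQ.int_pow_closed)
    have "(\<ominus>\<^bsub>Zmod q\<^esub> \<one>\<^bsub>Zmod q\<^esub>) \<otimes>\<^bsub>Zmod q\<^esub> z =
        (t [^]\<^bsub>Zstar q\<^esub> int (s div 2) \<otimes>\<^bsub>Zstar q\<^esub> k) \<otimes>\<^bsub>Zstar q\<^esub> (t [^]\<^bsub>Zstar q\<^esub> l \<otimes>\<^bsub>Zstar q\<^esub> h)"
      by (simp only: k(2) h(2) units_of_mult int_pow_int)
    also have "\<dots> = (t [^]\<^bsub>Zstar q\<^esub> int (s div 2) \<otimes>\<^bsub>Zstar q\<^esub> t [^]\<^bsub>Zstar q\<^esub> l) \<otimes>\<^bsub>Zstar q\<^esub> (k \<otimes>\<^bsub>Zstar q\<^esub> h)"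
      using c by (simp only: UQ.m_ac UQ.m_closed)
    also have "\<dots> = t [^]\<^bsub>Zstar q\<^esub> (int (s div 2) + l) \<otimes>\<^bsub>Zstar q\<^esub> (k \<otimes>\<^bsub>Zstar q\<^esub> h)"
      by (simp only: UQ.int_pow_mult[OF assms(8)])
    finally show ?thesis using H.m_closed[OF k(1) h(1)] unfolding l_coset_def by blast
  qed
  have zero: "a [^]\<^bsub>Zstar p\<^esub> (l::int) \<noteq> x \<ominus>\<^bsub>Zmod p\<^esub> x" if "x \<in> carrier (Zmod p)" for x l
  proof -
    have "a [^]\<^bsub>Zstar p\<^esub> l \<in> Units (Zmod p)"
      using UP.int_pow_closed[OF assms(6)] by (simp only: units_of_carrier)
    then show ?thesis using that P.field_Units by (auto simp: P.minus_eq P.r_neg)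
  qed
  let ?V = "carrier (Zmod p) \<times> carrier (Zmod q)"
  show ?thesis
  proof
    show "finite (parcs (graph_pq p q r a t))"
      by (rule finite_subset[of _ "?V \<times> ?V"]) (auto simp: graph_pq_def)
    show "symmetric (with_proj (graph_pq p q r a t))"
      unfolding symmetric_def
    proof (rule symI)
      fix e f assume "(e, f) \<in> arcs_ends (with_proj (graph_pq p q r a t))"
      then obtain i x j y and l :: int where e: "e = (i, x)" "f = (j, y)"
        and V: "i \<in> carrier (Zmod p)" "x \<in> carrier (Zmod q)" "j \<in> carrier (Zmod p)" "y \<in> carrier (Zmod q)"
        and l: "j \<ominus>\<^bsub>Zmod p\<^esub> i = a [^]\<^bsub>Zstar p\<^esub> l"
          "y \<ominus>\<^bsub>Zmod q\<^esub> x \<in> (t [^]\<^bsub>Zstar q\<^esub> l) <#\<^bsub>Zstar q\<^esub> Hsub q r"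
        unfolding graph_pq_def with_proj_simps pair_pre_digraph.simps by blast
      have "i \<ominus>\<^bsub>Zmod p\<^esub> j = a [^]\<^bsub>Zstar p\<^esub> (int (s div 2) + l)"
        unfolding swapP[OF V(1,3)] l(1) by (rule negP)
      moreover have "x \<ominus>\<^bsub>Zmod q\<^esub> y \<in> (t [^]\<^bsub>Zstar q\<^esub> (int (s div 2) + l)) <#\<^bsub>Zstar q\<^esub> Hsub q r"
        unfolding swapQ[OF V(2,4)] by (rule negQ[OF l(2)])
      ultimately show "(f, e) \<in> arcs_ends (with_proj (graph_pq p q r a t))"
        unfolding graph_pq_def with_proj_simps pair_pre_digraph.simps using e V by blast
    qed
  next
    fix e assume "e \<in> parcs (graph_pq p q r a t)"
    then show "fst e \<noteq> snd e"
      unfolding graph_pq_def pair_pre_digraph.simps using zero by fastforce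
  qed (auto simp: graph_pq_def)
qed

end

theory Submission
  imports Defs
begin

text \<open>
  Affine maps \<open>x \<mapsto> c x + b\<close> with \<open>c \<in> H(p, r)\<close> make \<open>G(p, r)\<close> symmetric, and products of symmetric
  graphs are symmetric. The arcs of \<open>G(pq; r, s, u)\<close> are arcs of the product because \<open>H(q, u)\<close>
  contains \<open>t\<close> and \<open>H(q, r)\<close>. Both graphs are finite on the same vertices, so they are isomorphic
  only if their arc sets coincide; then the arc from \<open>(0, 0)\<close> to \<open>(1, t)\<close> of the product gives
  an \<open>l\<close> with \<open>a\<^sup>l = 1\<close> and \<open>t \<in> t\<^sup>l H(q, r)\<close>. Since \<open>s\<close> divides \<open>l\<close> and \<open>t\<^sup>s \<in> H(q, r)\<close>,
  this means \<open>t \<in> H(q, r)\<close>.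
\<close>

section \<open>Symmetry of categorical products\<close>

lemma pair_wf_digraph_circulant_G: "pair_wf_digraph (circulant_G p r)"
  by unfold_locales (auto simp: circulant_G_def)

lemma pair_wf_digraph_categorical_product:
  assumes "pair_wf_digraph \<Gamma>" "pair_wf_digraph \<Psi>"
  shows "pair_wf_digraph (categorical_product \<Gamma> \<Psi>)"
proof -
  interpret A: pair_wf_digraph \<Gamma> by fact
  interpret B: pair_wf_digraph \<Psi> by fact
  show ?thesis
    by unfold_locales (auto simp: categorical_product_def dest: A.wellformed' B.wellformed')
qed

text \<open>Adjacency in the product is tested coordinatewise, so it is preserved coordinatewise.
  The restriction makes the map extensional, as membership in \<open>Bij\<close> demands.\<close>

lemma graph_automorphisms_categorical_product:
  assumes "f \<in> graph_automorphisms \<Gamma>" "g \<in> graph_automorphisms \<Psi>"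
  shows "restrict (map_prod f g) (pverts \<Gamma> \<times> pverts \<Psi>)
    \<in> graph_automorphisms (categorical_product \<Gamma> \<Psi>)"
proof -
  have "bij_betw f (pverts \<Gamma>) (pverts \<Gamma>)" "bij_betw g (pverts \<Psi>) (pverts \<Psi>)"
    using assms by (simp_all add: graph_automorphisms_def Bij_def)
  then have "bij_betw (map_prod f g) (pverts \<Gamma> \<times> pverts \<Psi>) (pverts \<Gamma> \<times> pverts \<Psi>)"
    by (rule bij_betw_map_prod)
  then have "restrict (map_prod f g) (pverts \<Gamma> \<times> pverts \<Psi>) \<in> Bij (pverts \<Gamma> \<times> pverts \<Psi>)"
    by (simp add: Bij_def)
  then show ?thesis
    using assms by (auto simp: graph_automorphisms_def categorical_product_def)
qed

text \<open>A vertex or arc of the product is a pair of vertices or arcs of the factors, so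
  automorphisms \<open>f\<close> and \<open>g\<close> can be chosen independently and
  combined.\<close>

lemma symmetric_graph_categorical_product:
  assumes wf: "pair_wf_digraph \<Gamma>" "pair_wf_digraph \<Psi>"
    and sym: "symmetric_graph \<Gamma>" "symmetric_graph \<Psi>"
  shows "symmetric_graph (categorical_product \<Gamma> \<Psi>)"
proof -
  interpret A: pair_wf_digraph \<Gamma> by fact
  interpret B: pair_wf_digraph \<Psi> by fact
  let ?P = "categorical_product \<Gamma> \<Psi>"
  note A = sym(1)[unfolded symmetric_graph_iff[OF wf(1)]]
  note B = sym(2)[unfolded symmetric_graph_iff[OF wf(2)]]
  have "\<exists>h\<in>graph_automorphisms ?P. h x = y" if xy: "x \<in> pverts ?P" "y \<in> pverts ?P" for x y
  proof -
    have v: "fst x \<in> pverts \<Gamma>" "snd x \<in> pverts \<Psi>" "fst y \<in> pverts \<Gamma>" "snd y \<in> pverts \<Psi>"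
      using xy by (auto simp: categorical_product_def)
    obtain f where f: "f \<in> graph_automorphisms \<Gamma>" "f (fst x) = fst y" using A v by blast
    obtain g where g: "g \<in> graph_automorphisms \<Psi>" "g (snd x) = snd y" using B v by blast
    show ?thesis
      by (rule bexI[OF _ graph_automorphisms_categorical_product[OF f(1) g(1)]])
        (use f g v in \<open>auto simp: mem_Times_iff map_prod_def case_prod_beta\<close>)
  qed
  moreover have "\<exists>h\<in>graph_automorphisms ?P. h x = x' \<and> h y = y'"
    if xy: "(x, y) \<in> parcs ?P" "(x', y') \<in> parcs ?P" for x y x' y'
  proof -
    have e: "(fst x, fst y) \<in> parcs \<Gamma>" "(snd x, snd y) \<in> parcs \<Psi>"
      "(fst x', fst y') \<in> parcs \<Gamma>" "(snd x', snd y') \<in> parcs \<Psi>"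
      using xy by (auto simp: categorical_product_def)
    \<comment> \<open>Endpoints of arcs are vertices, so the restricted product map agrees with
      \<open>map_prod f g\<close> there.\<close>
    then have v: "x \<in> pverts \<Gamma> \<times> pverts \<Psi>" "y \<in> pverts \<Gamma> \<times> pverts \<Psi>"
      by (auto simp: mem_Times_iff dest: A.wellformed' B.wellformed')
    obtain f where f: "f \<in> graph_automorphisms \<Gamma>" "f (fst x) = fst x'" "f (fst y) = fst y'"
      using A e by fast
    obtain g where g: "g \<in> graph_automorphisms \<Psi>" "g (snd x) = snd x'" "g (snd y) = snd y'"
      using B e by fast
    show ?thesis
      by (rule bexI[OF _ graph_automorphisms_categorical_product[OF f(1) g(1)]])
        (use f g v in \<open>auto simp: map_prod_def case_prod_beta\<close>)
  qed
  ultimately show ?thesis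
    unfolding symmetric_graph_iff[OF pair_wf_digraph_categorical_product[OF wf]] by auto
qed

section \<open>Affine automorphisms of circulant graphs\<close>

lemma (in cring) affine_diff:
  assumes "c \<in> carrier R" "b \<in> carrier R" "x \<in> carrier R" "y \<in> carrier R"
  shows "(c \<otimes> y \<oplus> b) \<ominus> (c \<otimes> x \<oplus> b) = c \<otimes> (y \<ominus> x)"
  using assms by algebra

text \<open>An affine map multiplies every difference by \<open>c\<close>, and multiplication by an
  element of the subgroup \<open>Hsub p r\<close> neither leaves nor enters it.\<close>

lemma affine_graph_automorphism:
  assumes "prime p" "r dvd p - 1" "c \<in> Hsub p r" "b \<in> carrier (Zmod p)"
  shows "(\<lambda>x\<in>carrier (Zmod p). c \<otimes>\<^bsub>Zmod p\<^esub> x \<oplus>\<^bsub>Zmod p\<^esub> b) \<in> graph_automorphisms (circulant_G p r)"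
proof -
  interpret residues_prime p "Zmod p" using assms(1) by unfold_locales simp
  interpret U: group "Zstar p" by (rule units_group)
  interpret H: subgroup "Hsub p r" "Zstar p" by (rule subgroup_Hsub[OF assms(1,2)])
  let ?f = "\<lambda>x. c \<otimes>\<^bsub>Zmod p\<^esub> x \<oplus>\<^bsub>Zmod p\<^esub> b"
  have cu: "c \<in> Units (Zmod p)" using H.mem_carrier[OF assms(3)] by (simp only: units_of_carrier)
  then have cc: "c \<in> carrier (Zmod p)" by blast
  have "inj_on ?f (carrier (Zmod p))"
    by (rule inj_onI) (use cu cc assms(4) in simp)
  moreover have "?f ` carrier (Zmod p) \<subseteq> carrier (Zmod p)" using cc assms(4) by blast
  \<comment> \<open>Injectivity comes from \<open>c\<close> being a unit; surjectivity follows
    because the carrier is finite.\<close>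
  ultimately have "bij_betw ?f (carrier (Zmod p)) (carrier (Zmod p))"
    by (simp add: bij_betw_def endo_inj_surj)
  then have "restrict ?f (carrier (Zmod p)) \<in> Bij (carrier (Zmod p))" by (simp add: Bij_def)
  moreover have "c \<otimes>\<^bsub>Zmod p\<^esub> z \<in> Hsub p r \<longleftrightarrow> z \<in> Hsub p r" if z: "z \<in> carrier (Zmod p)" for z
  proof
    \<comment> \<open>The inverse of \<open>c\<close> also lies in the subgroup, so multiplying by
      it recovers \<open>z\<close> inside the subgroup.\<close>
    let ?d = "inv\<^bsub>Zstar p\<^esub> c"
    assume "c \<otimes>\<^bsub>Zmod p\<^esub> z \<in> Hsub p r"
    then have "?d \<otimes>\<^bsub>Zmod p\<^esub> (c \<otimes>\<^bsub>Zmod p\<^esub> z) \<in> Hsub p r"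
      using H.m_closed[OF H.m_inv_closed[OF assms(3)]] by (simp add: units_of_mult)
    also have "?d \<otimes>\<^bsub>Zmod p\<^esub> (c \<otimes>\<^bsub>Zmod p\<^esub> z) = (?d \<otimes>\<^bsub>Zmod p\<^esub> c) \<otimes>\<^bsub>Zmod p\<^esub> z"
      using cc z cu by (simp only: units_of_inv m_assoc Units_inv_closed)
    also have "\<dots> = z" using cu z by (simp add: units_of_inv)
    finally show "z \<in> Hsub p r" .
  next
    assume "z \<in> Hsub p r"
    then show "c \<otimes>\<^bsub>Zmod p\<^esub> z \<in> Hsub p r"
      using H.m_closed[OF assms(3)] by (simp add: units_of_mult)
  qed
  ultimately show ?thesis
    using cc assms(4)
    by (simp add: graph_automorphisms_def circulant_G_def affine_diff)
qed

text \<open>Translations (\<open>c = 1\<close>) move any vertex to any other. For arcs, the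
  multiplier is the quotient of the two arc differences, again an element of
  \<open>Hsub p r\<close>.\<close>

lemma symmetric_graph_circulant_G:
  assumes "prime p" "r dvd p - 1"
  shows "symmetric_graph (circulant_G p r)"
proof -
  interpret residues_prime p "Zmod p" using assms(1) by unfold_locales simp
  interpret U: group "Zstar p" by (rule units_group)
  interpret H: subgroup "Hsub p r" "Zstar p" by (rule subgroup_Hsub[OF assms])
  \<comment> \<open>The translation part is chosen so that the affine map with multiplier
    \<open>c\<close> sends \<open>x\<close> to \<open>x'\<close>.\<close>
  have hom: "\<exists>f\<in>graph_automorphisms (circulant_G p r).
      \<forall>z\<in>carrier (Zmod p). f z = c \<otimes>\<^bsub>Zmod p\<^esub> z \<oplus>\<^bsub>Zmod p\<^esub> (x' \<ominus>\<^bsub>Zmod p\<^esub> c \<otimes>\<^bsub>Zmod p\<^esub> x)"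
    if "c \<in> Hsub p r" "x \<in> carrier (Zmod p)" "x' \<in> carrier (Zmod p)" for c x x'
  proof -
    have "c \<in> carrier (Zmod p)"
      using H.mem_carrier[OF that(1)] by (auto simp: units_of_carrier)
    then show ?thesis
      using that affine_graph_automorphism[OF assms that(1), of "x' \<ominus>\<^bsub>Zmod p\<^esub> c \<otimes>\<^bsub>Zmod p\<^esub> x"]
      by (intro bexI) auto
  qed
  have "\<exists>f\<in>graph_automorphisms (circulant_G p r). f x = x'"
    if x: "x \<in> carrier (Zmod p)" "x' \<in> carrier (Zmod p)" for x x'
  proof -
    have "\<one>\<^bsub>Zmod p\<^esub> \<in> Hsub p r" using H.one_closed by (simp only: units_of_one)
    from hom[OF this x] obtain f where f: "f \<in> graph_automorphisms (circulant_G p r)"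
      "f x = \<one>\<^bsub>Zmod p\<^esub> \<otimes>\<^bsub>Zmod p\<^esub> x \<oplus>\<^bsub>Zmod p\<^esub> (x' \<ominus>\<^bsub>Zmod p\<^esub> \<one>\<^bsub>Zmod p\<^esub> \<otimes>\<^bsub>Zmod p\<^esub> x)"
      using x by blast
    have "\<one>\<^bsub>Zmod p\<^esub> \<otimes>\<^bsub>Zmod p\<^esub> x \<oplus>\<^bsub>Zmod p\<^esub> (x' \<ominus>\<^bsub>Zmod p\<^esub> \<one>\<^bsub>Zmod p\<^esub> \<otimes>\<^bsub>Zmod p\<^esub> x) = x'"
      using x by algebra
    then show ?thesis using f by auto
  qed
  moreover have "\<exists>f\<in>graph_automorphisms (circulant_G p r). f x = x' \<and> f y = y'"
    if "(x, y) \<in> parcs (circulant_G p r)" "(x', y') \<in> parcs (circulant_G p r)" for x y x' y'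
  proof -
    have v: "x \<in> carrier (Zmod p)" "y \<in> carrier (Zmod p)" "x' \<in> carrier (Zmod p)" "y' \<in> carrier (Zmod p)"
      and h: "y \<ominus>\<^bsub>Zmod p\<^esub> x \<in> Hsub p r" "y' \<ominus>\<^bsub>Zmod p\<^esub> x' \<in> Hsub p r"
      using that by (auto simp: circulant_G_def)
    \<comment> \<open>The quotient \<open>c\<close> of \<open>y' - x'\<close> by
      \<open>y - x\<close> scales one arc difference to the other; the map sending \<open>x\<close>
      to \<open>x'\<close> then sends \<open>y\<close> to \<open>y'\<close>.\<close>
    define k where "k = inv\<^bsub>Zstar p\<^esub> (y \<ominus>\<^bsub>Zmod p\<^esub> x)"
    define c where "c = (y' \<ominus>\<^bsub>Zmod p\<^esub> x') \<otimes>\<^bsub>Zmod p\<^esub> k"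
    have kH: "k \<in> Hsub p r" using h by (simp add: k_def)
    have cH: "c \<in> Hsub p r"
      using H.m_closed[OF h(2) kH] by (simp add: c_def units_of_mult)
    have kc: "k \<in> carrier (Zmod p)" "c \<in> carrier (Zmod p)"
      using H.mem_carrier[OF kH] H.mem_carrier[OF cH] by (auto simp: units_of_carrier)
    have inv: "k \<otimes>\<^bsub>Zmod p\<^esub> (y \<ominus>\<^bsub>Zmod p\<^esub> x) = \<one>\<^bsub>Zmod p\<^esub>"
      using U.l_inv[OF H.mem_carrier[OF h(1)]] by (simp add: k_def units_of_mult units_of_one)
    have "c \<otimes>\<^bsub>Zmod p\<^esub> (y \<ominus>\<^bsub>Zmod p\<^esub> x) = (y' \<ominus>\<^bsub>Zmod p\<^esub> x') \<otimes>\<^bsub>Zmod p\<^esub> (k \<otimes>\<^bsub>Zmod p\<^esub> (y \<ominus>\<^bsub>Zmod p\<^esub> x))"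
      unfolding c_def by (rule m_assoc) (use kc v in auto)
    also have "\<dots> = y' \<ominus>\<^bsub>Zmod p\<^esub> x'" unfolding inv using v by simp
    finally have c: "c \<otimes>\<^bsub>Zmod p\<^esub> (y \<ominus>\<^bsub>Zmod p\<^esub> x) = y' \<ominus>\<^bsub>Zmod p\<^esub> x'" .
    obtain f where f: "f \<in> graph_automorphisms (circulant_G p r)"
      "\<forall>z\<in>carrier (Zmod p). f z = c \<otimes>\<^bsub>Zmod p\<^esub> z \<oplus>\<^bsub>Zmod p\<^esub> (x' \<ominus>\<^bsub>Zmod p\<^esub> c \<otimes>\<^bsub>Zmod p\<^esub> x)"
      using hom[OF cH v(1,3)] by blast
    have "c \<otimes>\<^bsub>Zmod p\<^esub> x \<oplus>\<^bsub>Zmod p\<^esub> (x' \<ominus>\<^bsub>Zmod p\<^esub> c \<otimes>\<^bsub>Zmod p\<^esub> x) = x'"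
      using v kc by algebra
    moreover have "c \<otimes>\<^bsub>Zmod p\<^esub> y \<oplus>\<^bsub>Zmod p\<^esub> (x' \<ominus>\<^bsub>Zmod p\<^esub> c \<otimes>\<^bsub>Zmod p\<^esub> x) =
        c \<otimes>\<^bsub>Zmod p\<^esub> (y \<ominus>\<^bsub>Zmod p\<^esub> x) \<oplus>\<^bsub>Zmod p\<^esub> x'"
      using v kc by algebra
    moreover have "(y' \<ominus>\<^bsub>Zmod p\<^esub> x') \<oplus>\<^bsub>Zmod p\<^esub> x' = y'" using v by algebra
    ultimately have "f x = x' \<and> f y = y'" using f(2) v by (simp only: c)
    then show ?thesis using f(1) by blast
  qed
  ultimately show ?thesis
    unfolding symmetric_graph_iff[OF pair_wf_digraph_circulant_G]
    by (auto simp: circulant_G_def)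
qed

section \<open>Inclusions of subgroups and isomorphisms of finite graphs\<close>

lemma Hsub_iff_ord_dvd:
  assumes "prime p" "r dvd p - 1" "x \<in> carrier (Zstar p)"
  shows "x \<in> Hsub p r \<longleftrightarrow> group.ord (Zstar p) x dvd r"
proof -
  interpret residues_prime p "Zmod p" using assms(1) by unfold_locales simp
  interpret U: group "Zstar p" by (rule units_group)
  \<comment> \<open>The subgroup consists of the \<open>r\<close>-th roots of unity, so membership
    says that the power \<open>r\<close> of \<open>x\<close> is one.\<close>
  show ?thesis
    using assms(3) U.pow_eq_id[OF assms(3), of r] by (simp add: Hsub_eq_roots[OF assms(1,2)])
qed

lemma Hsub_mono:
  assumes "prime p" "r dvd k" "k dvd p - 1"
  shows "Hsub p r \<subseteq> Hsub p k"
proof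
  fix x assume x: "x \<in> Hsub p r"
  have r: "r dvd p - 1" using assms dvd_trans by blast
  have "x \<in> carrier (Zstar p)"
    using x subgroup.mem_carrier[OF subgroup_Hsub[OF assms(1) r]] by blast
  then show "x \<in> Hsub p k"
    using x assms r dvd_trans by (simp add: Hsub_iff_ord_dvd) blast
qed

text \<open>Any isomorphism, whatever it does to the vertices, preserves the number of arcs, and a
  subset of a finite set with the same cardinality is the whole set.\<close>

lemma digraph_iso_parcs_eq:
  assumes "pair_fin_digraph H" "parcs G \<subseteq> parcs H" "digraph_iso (with_proj G) (with_proj H)"
  shows "parcs G = parcs H"
proof -
  interpret H: pair_fin_digraph H by fact
  obtain f where f: "pre_digraph.digraph_isomorphism (with_proj G) f"
    "with_proj H = app_iso f (with_proj G)"
    using assms(3) by (auto simp: digraph_iso_def)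
  have "parcs H = iso_arcs f ` parcs G"
    using arg_cong[OF f(2), of arcs] by simp
  then have "card (parcs H) = card (parcs G)"
    using pre_digraph.digraph_isomorphism_inj_on_arcs[OF f(1)] by (simp add: card_image)
  then show ?thesis by (intro card_subset_eq assms(2)) simp_all
qed

lemma digraph_iso_refl:
  assumes "wf_digraph G"
  shows "digraph_iso G G"
  unfolding digraph_iso_def
  \<comment> \<open>\<open>app_iso\<close> takes head and tail from the isomorphism record, so the
    identity must carry those of \<open>G\<close>.\<close>
  by (rule exI[of _ "\<lparr>iso_verts = id, iso_arcs = id, iso_head = head G, iso_tail = tail G\<rparr>"])
    (simp add: assms pre_digraph.digraph_isomorphism_def app_iso_def)

section \<open>Comparison of \<open>graph_pq\<close> with the product\<close>

theorem lemma4p13: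
  fixes p q r s u :: nat and a t :: int
  assumes "prime p" and "prime q" and "p < q"
    and "even s" and "s dvd p - 1"
    and "r dvd q - 1"
    and "a \<in> carrier (Zstar p)"
    and "Hsub p s = generate (Zstar p) {a}"
    and "t \<in> carrier (Zstar q)"
    and "t [^]\<^bsub>Zstar q\<^esub> (s div 2) \<in> a_inv (Zmod q) ` Hsub q r"
    and "u = lcm r (group.ord (Zstar q) t)"
  shows "symmetric_graph (categorical_product (circulant_G p s) (circulant_G q u)) \<and>
    (\<exists>S :: (int \<times> int) pair_pre_digraph.
       pair_graph S \<and>
       spanning (with_proj S)
         (with_proj (categorical_product (circulant_G p s) (circulant_G q u))) \<and>
       digraph_iso (with_proj (graph_pq p q r a t)) (with_proj S)) \<and>
    (digraph_iso (with_proj (graph_pq p q r a t))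
       (with_proj (categorical_product (circulant_G p s) (circulant_G q u)))
     \<longleftrightarrow> t \<in> Hsub q r)"
proof -
  interpret P: residues_prime p "Zmod p" using assms(1) by unfold_locales simp
  interpret Q: residues_prime q "Zmod q" using assms(2) by unfold_locales simp
  interpret UP: group "Zstar p" by (rule P.units_group)
  interpret UQ: group "Zstar q" by (rule Q.units_group)
  let ?G = "graph_pq p q r a t"
  let ?P = "categorical_product (circulant_G p s) (circulant_G q u)"
  have u: "u dvd q - 1" unfolding assms(11) by (rule lcm_ord_dvd[OF assms(2,6,9)])
  interpret H: subgroup "Hsub q r" "Zstar q" by (rule subgroup_Hsub[OF assms(2,6)])
  interpret K: subgroup "Hsub q u" "Zstar q" by (rule subgroup_Hsub[OF assms(2) u])
  interpret S: subgroup "Hsub p s" "Zstar p" by (rule subgroup_Hsub[OF assms(1,5)])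
  have tK: "t \<in> Hsub q u"
    using Hsub_iff_ord_dvd[OF assms(2) u assms(9)] by (simp add: assms(11))
  have HK: "Hsub q r \<subseteq> Hsub q u"
    by (rule Hsub_mono[OF assms(2) _ u]) (simp add: assms(11))
  have aS: "a \<in> Hsub p s" unfolding assms(8) by (rule generate.incl) simp
  have G: "pair_graph ?G" by (rule pair_graph_graph_pq) (rule assms)+
  have P: "pair_graph ?P"
  proof (rule pair_graph_categorical_product)
    show "pair_graph (circulant_G p s)"
      by (rule pair_graph_circulant_G[OF assms(1,5) minus_one_in_Hsub[OF assms(1,5,4)]])
    show "pair_graph (circulant_G q u)"
      unfolding assms(11) by (rule pair_graph_circulant_lcm[OF assms(2,6,9,10)])
  qed
  interpret G: pair_graph ?G by (rule G)
  interpret P: pair_graph ?P by (rule P)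
  have sub: "parcs ?G \<subseteq> parcs ?P"
  proof
    fix e assume "e \<in> parcs ?G"
    then obtain i x j y and l :: int and h where e: "e = ((i, x), (j, y))"
      "i \<in> carrier (Zmod p)" "x \<in> carrier (Zmod q)" "j \<in> carrier (Zmod p)" "y \<in> carrier (Zmod q)"
      and l: "j \<ominus>\<^bsub>Zmod p\<^esub> i = a [^]\<^bsub>Zstar p\<^esub> l"
        "y \<ominus>\<^bsub>Zmod q\<^esub> x = t [^]\<^bsub>Zstar q\<^esub> l \<otimes>\<^bsub>Zstar q\<^esub> h" "h \<in> Hsub q r"
      unfolding graph_pq_def l_coset_def pair_pre_digraph.simps by blast
    have "a [^]\<^bsub>Zstar p\<^esub> l \<in> Hsub p s"
      by (rule UP.subgroup_int_pow_closed[OF S.subgroup_axioms aS])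
    moreover have "t [^]\<^bsub>Zstar q\<^esub> l \<otimes>\<^bsub>Zstar q\<^esub> h \<in> Hsub q u"
      using UQ.subgroup_int_pow_closed[OF K.subgroup_axioms tK] HK l(3) by blast
    ultimately show "e \<in> parcs ?P"
      using e l by (simp add: categorical_product_def circulant_G_def)
  qed
  have verts: "pverts ?G = pverts ?P"
    by (simp add: graph_pq_def categorical_product_def circulant_G_def)
  have "symmetric_graph ?P"
    by (intro symmetric_graph_categorical_product pair_wf_digraph_circulant_G
        symmetric_graph_circulant_G assms(1,2,5) u)
  \<comment> \<open>The graph itself serves as the spanning subgraph \<open>S\<close>, so the
    isomorphism onto \<open>S\<close> is the identity.\<close>
  moreover have "spanning (with_proj ?G) (with_proj ?P)"
    using sub verts G.wf_digraph P.wf_digraph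
    by (simp add: spanning_def subgraph_def compatible_def)
  moreover have refl: "digraph_iso (with_proj ?G) (with_proj ?G)"
    by (rule digraph_iso_refl[OF G.wf_digraph])
  moreover have "t \<in> Hsub q r" if iso: "digraph_iso (with_proj ?G) (with_proj ?P)"
  proof -
    have eq: "parcs ?G = parcs ?P"
      by (rule digraph_iso_parcs_eq[OF _ sub iso]) unfold_locales
    have tc: "t \<in> carrier (Zmod q)" using assms(9) by (auto simp: units_of_carrier)
    have diff: "\<one>\<^bsub>Zmod p\<^esub> \<ominus>\<^bsub>Zmod p\<^esub> \<zero>\<^bsub>Zmod p\<^esub> = \<one>\<^bsub>Zmod p\<^esub>" "t \<ominus>\<^bsub>Zmod q\<^esub> \<zero>\<^bsub>Zmod q\<^esub> = t"
      using tc by (simp_all add: P.minus_eq Q.minus_eq)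
    \<comment> \<open>This arc exists because 1 lies in \<open>Hsub p s\<close> and \<open>t\<close>
      in \<open>Hsub q u\<close>; read in \<open>?G\<close>, it constrains \<open>t\<close>.\<close>
    have "((\<zero>\<^bsub>Zmod p\<^esub>, \<zero>\<^bsub>Zmod q\<^esub>), (\<one>\<^bsub>Zmod p\<^esub>, t)) \<in> parcs ?P"
      using S.one_closed tK tc diff
      by (simp add: categorical_product_def circulant_G_def units_of_one)
    then obtain l :: int and h where l: "\<one>\<^bsub>Zmod p\<^esub> = a [^]\<^bsub>Zstar p\<^esub> l"
      "t = t [^]\<^bsub>Zstar q\<^esub> l \<otimes>\<^bsub>Zstar q\<^esub> h" "h \<in> Hsub q r"
      unfolding eq[symmetric] using diff
      by (auto simp add: graph_pq_def l_coset_def simp del: P.res_one_eq Q.res_zero_eq P.res_zero_eq)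
    \<comment> \<open>The order of \<open>a\<close> is the size of the subgroup it generates, so a
      trivial power of \<open>a\<close> has an exponent divisible by \<open>s\<close>.\<close>
    have "UP.ord a = s"
      using UP.generate_pow_card[OF assms(7)] assms(8) card_Hsub[OF assms(1,5)] by simp
    then have "int s dvd l"
      using l(1) UP.int_pow_eq_id[OF assms(7), of l] by (simp add: units_of_one)
    then obtain k where k: "l = int s * k" by blast
    obtain h' where h': "h' \<in> Hsub q r" "t [^]\<^bsub>Zstar q\<^esub> (s div 2) = \<ominus>\<^bsub>Zmod q\<^esub> h'"
      using assms(10) by blast
    have hc: "h' \<in> carrier (Zmod q)" using H.mem_carrier[OF h'(1)] by (auto simp: units_of_carrier)
    \<comment> \<open>Squaring the hypothesis on \<open>t\<close> removes the sign: the power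
      \<open>s\<close> of \<open>t\<close> is the square of \<open>h'\<close>, hence in
      \<open>Hsub q r\<close>.\<close>
    have "t [^]\<^bsub>Zstar q\<^esub> s = t [^]\<^bsub>Zstar q\<^esub> (s div 2) \<otimes>\<^bsub>Zstar q\<^esub> t [^]\<^bsub>Zstar q\<^esub> (s div 2)"
      using assms(4,9) by (simp add: UQ.nat_pow_mult flip: mult_2)
    also have "\<dots> = h' \<otimes>\<^bsub>Zstar q\<^esub> h'"
      using hc by (simp add: h'(2) units_of_mult Q.l_minus Q.r_minus)
    also have "\<dots> \<in> Hsub q r" using h'(1) by (rule H.m_closed) (rule h'(1))
    finally have "(t [^]\<^bsub>Zstar q\<^esub> s) [^]\<^bsub>Zstar q\<^esub> k \<in> Hsub q r"
      by (rule UQ.subgroup_int_pow_closed[OF H.subgroup_axioms])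
    also have "(t [^]\<^bsub>Zstar q\<^esub> s) [^]\<^bsub>Zstar q\<^esub> k = t [^]\<^bsub>Zstar q\<^esub> l"
      using UQ.int_pow_pow[OF assms(9), of "int s" k] by (simp add: k int_pow_int mult.commute)
    \<comment> \<open>Both factors of \<open>t\<close>, its power \<open>l\<close> and
      \<open>h\<close>, now lie in \<open>Hsub q r\<close>.\<close>
    finally show ?thesis using l(2,3) H.m_closed by metis
  qed
  moreover have "digraph_iso (with_proj ?G) (with_proj ?P)" if t: "t \<in> Hsub q r"
  proof -
    \<comment> \<open>Here the order of \<open>t\<close> divides \<open>r\<close>, so the lcm
      collapses and the second factor has connection set \<open>Hsub q r\<close>.\<close>
    have ur: "u = r"
      using t Hsub_iff_ord_dvd[OF assms(2,6,9)] by (simp add: assms(11) lcm_proj1_if_dvd_nat)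
    have "parcs ?P \<subseteq> parcs ?G"
    proof
      fix e assume "e \<in> parcs ?P"
      then obtain i x j y where e: "e = ((i, x), (j, y))"
        "i \<in> carrier (Zmod p)" "x \<in> carrier (Zmod q)" "j \<in> carrier (Zmod p)" "y \<in> carrier (Zmod q)"
        and d: "j \<ominus>\<^bsub>Zmod p\<^esub> i \<in> Hsub p s" "y \<ominus>\<^bsub>Zmod q\<^esub> x \<in> Hsub q r"
        unfolding categorical_product_def circulant_G_def ur by auto
      obtain l :: int where l: "j \<ominus>\<^bsub>Zmod p\<^esub> i = a [^]\<^bsub>Zstar p\<^esub> l"
        using d(1) unfolding assms(8) UP.generate_pow[OF assms(7)] by blast
      \<comment> \<open>The coset is the subgroup itself for every \<open>l\<close>, so the two
        coordinate conditions decouple and any \<open>l\<close> matching the first coordinate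
        works.\<close>
      have "t [^]\<^bsub>Zstar q\<^esub> l <#\<^bsub>Zstar q\<^esub> Hsub q r = Hsub q r"
        by (rule UQ.coset_join3[OF _ H.subgroup_axioms])
          (use UQ.subgroup_int_pow_closed[OF H.subgroup_axioms t] assms(9) in auto)
      then show "e \<in> parcs ?G" using e l d(2) unfolding graph_pq_def by auto
    qed
    \<comment> \<open>The two graphs are equal outright, so reflexivity gives the
      isomorphism.\<close>
    then have "?G = ?P" using sub verts by (intro pair_pre_digraph.equality) auto
    then show ?thesis using refl by simp
  qed
  ultimately show ?thesis using G by blast
qed

end
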